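(* The class of $X$-free chordal bipartite graphs is factorial.
   Context: All graphs are finite and simple. $G$ is $H$-free if it has no induced subgraph isomorphic to $H$. $X$ is the 7-vertex graph consisting of a cycle $C_4$ on vertices $c_1,c_2,c_3,c_4$, a vertex $p$ adjacent to $c_1$, and two further vertices $q,r$ each adjacent only to $p$ (edges: $c_1c_2,c_2c_3,c_3c_4,c_4c_1,c_1p,pq,pr$). A bipartite graph is chordal bipartite if it has no induced cycles of length at least $6$. A hereditary class (closed under taking induced subgraphs) is factorial if the number of labelled graphs in it on vertex set $\{1,\dots,n\}$ is $2^{\Theta(n\log n)}$. *)

theory Defs
  imports Complex_Main "HOL-Library.Landau_Symbols"
begin

text \<open>Graphs are pairs of a vertex set and a set of two-element edges.\<close>

type_synonym 'a graph = "'a set \<times> 'a set set"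

abbreviation verts :: "'a graph \<Rightarrow> 'a set" where
  "verts \<equiv> fst"

abbreviation edges :: "'a graph \<Rightarrow> 'a set set" where
  "edges \<equiv> snd"

definition simple_graph :: "'a graph \<Rightarrow> bool" where
  "simple_graph G \<longleftrightarrow> finite (verts G) \<and> (\<forall>e\<in>edges G. e \<subseteq> verts G \<and> card e = 2)"

definition induced :: "'a graph \<Rightarrow> 'a set \<Rightarrow> 'a graph" where
  "induced G W = (W, {e \<in> edges G. e \<subseteq> W})"

definition isomorphic :: "'a graph \<Rightarrow> 'b graph \<Rightarrow> bool" where
  "isomorphic G H \<longleftrightarrow>
     (\<exists>f. bij_betw f (verts G) (verts H) \<and>
          (\<forall>u\<in>verts G. \<forall>v\<in>verts G. {u, v} \<in> edges G \<longleftrightarrow> {f u, f v} \<in> edges H))"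

definition free_of :: "'b graph \<Rightarrow> 'a graph \<Rightarrow> bool" where
  "free_of H G \<longleftrightarrow> \<not> (\<exists>W\<subseteq>verts G. isomorphic (induced G W) H)"

definition cycle_graph :: "nat \<Rightarrow> nat graph" where
  "cycle_graph k = ({0..<k}, {{i, (i + 1) mod k} | i. i < k})"

definition bipartite :: "'a graph \<Rightarrow> bool" where
  "bipartite G \<longleftrightarrow>
     (\<exists>A B. A \<union> B = verts G \<and> A \<inter> B = {} \<and>
            (\<forall>e\<in>edges G. \<exists>a\<in>A. \<exists>b\<in>B. e = {a, b}))"

definition chordal_bipartite :: "'a graph \<Rightarrow> bool" where
  "chordal_bipartite G \<longleftrightarrow> bipartite G \<and> (\<forall>k\<ge>6. free_of (cycle_graph k) G)"

text \<open>The cycle is \<open>1, 2, 3, 4\<close>; the vertex \<open>5\<close> is adjacent to \<open>1\<close> and to the two leaves \<open>6, 7\<close>.\<close>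

definition X_graph :: "nat graph" where
  "X_graph = ({1, 2, 3, 4, 5, 6, 7},
              {{1, 2}, {2, 3}, {3, 4}, {4, 1}, {1, 5}, {5, 6}, {5, 7}})"

text \<open>
  Every finite graph is isomorphic to one with vertices in \<open>nat\<close>, so a class of finite
  graphs is represented by its members on \<open>nat\<close>, and is required to be closed under
  isomorphism.
\<close>

definition graph_class :: "nat graph set \<Rightarrow> bool" where
  "graph_class C \<longleftrightarrow>
     (\<forall>G\<in>C. simple_graph G) \<and>
     (\<forall>G\<in>C. \<forall>H. simple_graph H \<and> isomorphic G H \<longrightarrow> H \<in> C)"

definition hereditary :: "nat graph set \<Rightarrow> bool" where
  "hereditary C \<longleftrightarrow> graph_class C \<and> (\<forall>G\<in>C. \<forall>W\<subseteq>verts G. induced G W \<in> C)"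

definition labelled_count :: "nat graph set \<Rightarrow> nat \<Rightarrow> nat" where
  "labelled_count C n = card {G \<in> C. verts G = {1..n}}"

definition factorial_class :: "nat graph set \<Rightarrow> bool" where
  "factorial_class C \<longleftrightarrow> hereditary C \<and>
     (\<exists>f :: nat \<Rightarrow> real. f \<in> \<Theta>(\<lambda>n. real n * log 2 (real n)) \<and>
        (\<forall>n\<ge>1. real (labelled_count C n) = 2 powr f n))"

definition X_free_chordal_bipartite :: "nat graph set" where
  "X_free_chordal_bipartite =
     {G. simple_graph G \<and> chordal_bipartite G \<and> free_of X_graph G}"

end

theory Submission imports Defs "HOL-Library.FuncSet" begin

text \<open>
  Upper bound: fix the vertex set and repeatedly delete edges whose ends lie in different components
  afterwards. This preserves the class, because cycles and \<open>X\<close> are connected, and it increases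
  the number of components, so fewer than \<open>n\<close> steps lead to the edgeless graph. It suffices
  that each step can be chosen so that it is undone by one of polynomially many moves. A vertex of
  degree at most two, a bridge, or a vertex whose neighbourhood differs little from that of another
  vertex can clearly be restored that way. If none of these exist, let \<open>p\<close> have maximum
  degree. Each vertex \<open>x\<close> at distance two from \<open>p\<close> misses at least two neighbours of
  \<open>p\<close>, and then the absence of \<open>X\<close> and of long induced cycles shows that the sets
  \<open>N(x) - N(p)\<close> are disjoint, that \<open>x\<close> has only one neighbour in \<open>N(p)\<close> if
  \<open>N(x) - N(p)\<close> is nonempty, and that the edge to this neighbour is a bridge. So
  \<open>N(x) \<subseteq> N(p)\<close> throughout, and \<open>p\<close> dominates the opposite side of its component. The
  same holds for a suitable neighbour \<open>q\<close> of \<open>p\<close>, hence \<open>N(p)\<close> consists of the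
  vertices at distance zero or two from \<open>q\<close> in the graph without \<open>p\<close>.

  Lower bound: star forests.
\<close>

section \<open>Adjacency, connectivity and deletion of edges between components\<close>

definition nbrs :: "'a set set \<Rightarrow> 'a \<Rightarrow> 'a set" where
  "nbrs E v = {w. {v, w} \<in> E}"

definition conn :: "'a set set \<Rightarrow> ('a \<times> 'a) set" where
  "conn E = {(u, v). {u, v} \<in> E}\<^sup>*"

definition connected_graph :: "'a graph \<Rightarrow> bool" where
  "connected_graph G \<longleftrightarrow> (\<forall>u\<in>verts G. \<forall>v\<in>verts G. (u, v) \<in> conn (edges G))"

text \<open>A deleted edge has to join two different components of \<open>E'\<close>, so each
  component of \<open>E'\<close> spans the same edges in \<open>E\<close> as in
  \<open>E'\<close>.\<close>

definition splits :: "'a set set \<Rightarrow> 'a set set \<Rightarrow> bool" where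
  "splits E E' \<longleftrightarrow> E' \<subset> E \<and> (\<forall>u v. {u, v} \<in> E - E' \<longrightarrow> (u, v) \<notin> conn E')"

lemma nbrs_iff [simp]: "w \<in> nbrs E v \<longleftrightarrow> {v, w} \<in> E"
  by (simp add: nbrs_def)

lemma conn_refl [simp]: "(u, u) \<in> conn E"
  by (simp add: conn_def)

lemma conn_edge: "{u, v} \<in> E \<Longrightarrow> (u, v) \<in> conn E"
  by (auto simp: conn_def)

lemma conn_trans: "(u, v) \<in> conn E \<Longrightarrow> (v, w) \<in> conn E \<Longrightarrow> (u, w) \<in> conn E"
  unfolding conn_def by (rule rtrancl_trans)

lemma conn_sym: "(u, v) \<in> conn E \<Longrightarrow> (v, u) \<in> conn E"
proof -
  have "sym {(u, v). {u, v} \<in> E}" by (auto intro!: symI simp: insert_commute)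
  then show "(u, v) \<in> conn E \<Longrightarrow> (v, u) \<in> conn E"
    unfolding conn_def by (blast dest: sym_rtrancl symD)
qed

lemma conn_mono: "E' \<subseteq> E \<Longrightarrow> conn E' \<subseteq> conn E"
  unfolding conn_def by (rule rtrancl_mono) auto

section \<open>Isomorphism, induced subgraphs and heredity\<close>

lemma isomorphic_sym:
  assumes "isomorphic G H" shows "isomorphic H G"
proof -
  obtain f where f: "bij_betw f (verts G) (verts H)"
    and e: "\<And>u v. u \<in> verts G \<Longrightarrow> v \<in> verts G \<Longrightarrow> {u, v} \<in> edges G \<longleftrightarrow> {f u, f v} \<in> edges H"
    using assms unfolding isomorphic_def by auto
  let ?g = "inv_into (verts G) f"
  have "\<And>u. u \<in> verts H \<Longrightarrow> ?g u \<in> verts G \<and> f (?g u) = u"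
    using f by (auto simp: bij_betw_def f_inv_into_f inv_into_into)
  then show ?thesis
    unfolding isomorphic_def by (intro exI[of _ ?g]) (auto simp: e bij_betw_inv_into[OF f])
qed

lemma isomorphic_trans:
  assumes "isomorphic G H" "isomorphic H K" shows "isomorphic G K"
proof -
  obtain f g where f: "bij_betw f (verts G) (verts H)" and g: "bij_betw g (verts H) (verts K)"
    and ef: "\<And>u v. u \<in> verts G \<Longrightarrow> v \<in> verts G \<Longrightarrow> {u, v} \<in> edges G \<longleftrightarrow> {f u, f v} \<in> edges H"
    and eg: "\<And>u v. u \<in> verts H \<Longrightarrow> v \<in> verts H \<Longrightarrow> {u, v} \<in> edges H \<longleftrightarrow> {g u, g v} \<in> edges K"
    using assms unfolding isomorphic_def by auto
  have "bij_betw (g \<circ> f) (verts G) (verts K)" using f g by (rule bij_betw_trans)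
  moreover have "{u, v} \<in> edges G \<longleftrightarrow> {(g \<circ> f) u, (g \<circ> f) v} \<in> edges K"
    if "u \<in> verts G" "v \<in> verts G" for u v
    using ef[OF that] eg[of "f u" "f v"] that bij_betw_apply[OF f] by simp
  ultimately show ?thesis unfolding isomorphic_def by blast
qed

lemma induced_induced: "W' \<subseteq> W \<Longrightarrow> induced (induced G W) W' = induced G W'"
  unfolding induced_def by auto

lemma verts_induced [simp]: "verts (induced G W) = W"
  by (simp add: induced_def)

lemma isomorphic_induced:
  assumes "isomorphic G H" "W \<subseteq> verts H"
  obtains W' where "W' \<subseteq> verts G" "isomorphic (induced G W') (induced H W)"
proof -
  obtain f where f: "bij_betw f (verts G) (verts H)"
    and e: "\<And>u v. u \<in> verts G \<Longrightarrow> v \<in> verts G \<Longrightarrow> {u, v} \<in> edges G \<longleftrightarrow> {f u, f v} \<in> edges H"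
    using assms(1) unfolding isomorphic_def by auto
  define W' where "W' = {v \<in> verts G. f v \<in> W}"
  have "bij_betw f W' W"
    using f assms(2) unfolding W'_def bij_betw_def inj_on_def by fastforce
  moreover have "{u, v} \<in> edges (induced G W') \<longleftrightarrow> {f u, f v} \<in> edges (induced H W)"
    if "u \<in> W'" "v \<in> W'" for u v
    using that e[of u v] unfolding induced_def W'_def by auto
  ultimately have "isomorphic (induced G W') (induced H W)"
    unfolding isomorphic_def by auto
  moreover have "W' \<subseteq> verts G" by (auto simp: W'_def)
  ultimately show ?thesis using that by blast
qed

lemma free_of_isomorphic:
  assumes "isomorphic G H" "free_of F G" shows "free_of F H"
  unfolding free_of_def
proof clarify
  fix W assume W: "W \<subseteq> verts H" "isomorphic (induced H W) F"
  obtain W' where "W' \<subseteq> verts G" "isomorphic (induced G W') (induced H W)"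
    using isomorphic_induced[OF assms(1) W(1)] by blast
  with W(2) assms(2) show False unfolding free_of_def using isomorphic_trans by blast
qed

lemma free_of_induced:
  assumes "free_of F G" "W \<subseteq> verts G" shows "free_of F (induced G W)"
  unfolding free_of_def
proof (clarsimp)
  fix W' assume "W' \<subseteq> W" "isomorphic (induced (induced G W) W') F"
  then show False using assms by (auto simp: free_of_def induced_induced)
qed

lemma not_free_of_embedding:
  assumes "inj_on g (verts H)" "g ` verts H \<subseteq> verts G"
    and "\<And>a b. a \<in> verts H \<Longrightarrow> b \<in> verts H \<Longrightarrow> {a, b} \<in> edges H \<longleftrightarrow> {g a, g b} \<in> edges G"
  shows "\<not> free_of H G"
proof -
  have "isomorphic H (induced G (g ` verts H))"
    using assms unfolding isomorphic_def by (intro exI[of _ g]) (auto simp: bij_betw_def induced_def)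
  then show ?thesis using assms(2) isomorphic_sym unfolding free_of_def by blast
qed

text \<open>\<open>isomorphic\<close> only compares sets \<open>{u, v}\<close> of vertices.
  Simplicity of \<open>H\<close> ensures that every edge of \<open>H\<close> has this form, so that
  the two sides can be carried over.\<close>

lemma bipartite_isomorphic:
  assumes "isomorphic G H" "bipartite G" "simple_graph H" shows "bipartite H"
proof -
  obtain f where f: "bij_betw f (verts G) (verts H)"
    and e: "\<And>u v. u \<in> verts G \<Longrightarrow> v \<in> verts G \<Longrightarrow> {u, v} \<in> edges G \<longleftrightarrow> {f u, f v} \<in> edges H"
    using assms(1) unfolding isomorphic_def by auto
  obtain A B where AB: "A \<union> B = verts G" "A \<inter> B = {}"
      "\<forall>e\<in>edges G. \<exists>a\<in>A. \<exists>b\<in>B. e = {a, b}"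
    using assms(2) unfolding bipartite_def by auto
  have "\<exists>a\<in>f ` A. \<exists>b\<in>f ` B. d = {a, b}" if "d \<in> edges H" for d
  proof -
    have card: "card d = 2" and sub: "d \<subseteq> verts H"
      using that assms(3) by (auto simp: simple_graph_def)
    obtain u' v' where d: "d = {u', v'}" using card by (auto simp: card_2_iff)
    obtain u v where uv: "u \<in> verts G" "v \<in> verts G" "u' = f u" "v' = f v"
    proof -
      have "u' \<in> f ` verts G" "v' \<in> f ` verts G" using f sub d by (simp_all add: bij_betw_def)
      then show thesis using that by (elim imageE) simp
    qed
    then have "{u, v} \<in> edges G" using e[of u v] d that by simp
    then obtain a b where ab: "a \<in> A" "b \<in> B" "{u, v} = {a, b}" using AB(3) by blast
    have "d = f ` {u, v}" using d uv by simp
    also have "\<dots> = {f a, f b}" unfolding ab(3) by simp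
    finally show ?thesis using ab by blast
  qed
  moreover have "f ` A \<union> f ` B = verts H"
    using AB(1) f by (simp add: bij_betw_def flip: image_Un)
  moreover have "f ` A \<inter> f ` B = {}"
    using AB(1,2) f inj_on_image_Int[of f "verts G" A B] by (auto simp: bij_betw_def)
  ultimately show ?thesis
    unfolding bipartite_def by (intro exI[of _ "f ` A"] exI[of _ "f ` B"]) simp
qed

lemma bipartite_induced:
  assumes "bipartite G" "W \<subseteq> verts G" shows "bipartite (induced G W)"
proof -
  obtain A B where AB: "A \<union> B = verts G" "A \<inter> B = {}"
      "\<forall>e\<in>edges G. \<exists>a\<in>A. \<exists>b\<in>B. e = {a, b}"
    using assms(1) unfolding bipartite_def by auto
  have "\<forall>e\<in>edges (induced G W). \<exists>a\<in>A \<inter> W. \<exists>b\<in>B \<inter> W. e = {a, b}"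
    using AB(3) unfolding induced_def by fastforce
  moreover have "(A \<inter> W) \<union> (B \<inter> W) = verts (induced G W)" "(A \<inter> W) \<inter> (B \<inter> W) = {}"
    using AB assms(2) by auto
  ultimately show ?thesis unfolding bipartite_def by blast
qed

lemma hereditary_X_free_chordal_bipartite: "hereditary X_free_chordal_bipartite"
proof -
  have "simple_graph (induced G W)" if "simple_graph G" "W \<subseteq> verts G" for G :: "nat graph" and W
    using that unfolding simple_graph_def induced_def by (auto intro: finite_subset)
  then have "induced G W \<in> X_free_chordal_bipartite"
    if "G \<in> X_free_chordal_bipartite" "W \<subseteq> verts G" for G W
    using that(1) free_of_induced[OF _ that(2)] bipartite_induced[OF _ that(2)] that(2)
    unfolding X_free_chordal_bipartite_def chordal_bipartite_def by blast
  note closed_induced = this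
  have closed_iso: "H \<in> X_free_chordal_bipartite"
    if "G \<in> X_free_chordal_bipartite" "simple_graph H" "isomorphic G H" for G H
    using that(1,2) free_of_isomorphic[OF that(3)] bipartite_isomorphic[OF that(3)]
    unfolding X_free_chordal_bipartite_def chordal_bipartite_def by blast
  show ?thesis
    unfolding hereditary_def graph_class_def
  proof (intro conjI ballI allI impI)
    show "simple_graph G" if "G \<in> X_free_chordal_bipartite" for G
      using that by (simp add: X_free_chordal_bipartite_def)
    show "H \<in> X_free_chordal_bipartite"
      if "G \<in> X_free_chordal_bipartite" "simple_graph H \<and> isomorphic G H" for G H
      using that closed_iso by blast
    show "induced G W \<in> X_free_chordal_bipartite"
      if "G \<in> X_free_chordal_bipartite" "W \<subseteq> verts G" for G W
      by (fact closed_induced[OF that])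
  qed
qed

section \<open>Deleting edges between components\<close>

text \<open>A map preserving edges carries walks to walks; simplicity of \<open>H\<close> keeps the
  walk inside the vertex set, where \<open>f\<close> is controlled.\<close>

lemma conn_simple_graph:
  assumes "(a, b) \<in> conn (edges H)" "a \<in> verts H" "simple_graph H"
    and "\<And>a b. a \<in> verts H \<Longrightarrow> b \<in> verts H \<Longrightarrow> {a, b} \<in> edges H \<Longrightarrow> {f a, f b} \<in> E"
  shows "b \<in> verts H \<and> (f a, f b) \<in> conn E"
  using assms(1) unfolding conn_def
proof (induction rule: rtrancl_induct)
  case (step b c)
  then have "c \<in> verts H" using assms(3) unfolding simple_graph_def by auto
  with step assms(4)[of b c] show ?case by (auto intro: rtrancl_into_rtrancl)
qed (use assms in auto)

text \<open>A copy of \<open>H\<close> induced in \<open>E'\<close> lies within one component of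
  \<open>E'\<close>. Hence no edge of \<open>E\<close> between its vertices has been deleted, and
  the copy is induced in \<open>E\<close> as well.\<close>

lemma splits_free_of:
  assumes "splits E E'" "connected_graph H" "simple_graph H" "free_of H (V, E)"
  shows "free_of H (V, E')"
  unfolding free_of_def
proof clarsimp
  fix W assume W: "W \<subseteq> V" and iso: "isomorphic (induced (V, E') W) H"
  obtain f where f: "bij_betw f (verts H) W"
    and e: "\<And>u v. u \<in> verts H \<Longrightarrow> v \<in> verts H \<Longrightarrow>
        {u, v} \<in> edges H \<longleftrightarrow> {f u, f v} \<in> edges (induced (V, E') W)"
    using isomorphic_sym[OF iso] unfolding isomorphic_def by auto
  have conn: "(u, v) \<in> conn E'" if uv: "u \<in> W" "v \<in> W" for u v
  proof -
    obtain a b where ab: "a \<in> verts H" "b \<in> verts H" "u = f a" "v = f b"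
      using uv f unfolding bij_betw_def by blast
    then have "(a, b) \<in> conn (edges H)" using assms(2) by (auto simp: connected_graph_def)
    then show ?thesis
      using conn_simple_graph[of a b H f E'] ab assms(3) e by (auto simp: induced_def)
  qed
  have "{f u, f v} \<in> E \<longleftrightarrow> {f u, f v} \<in> E'" if "u \<in> verts H" "v \<in> verts H" for u v
    using conn[of "f u" "f v"] that f assms(1) by (auto simp: splits_def bij_betw_def)
  then have "\<not> free_of H (V, E)"
    using f W e by (intro not_free_of_embedding[of f]) (auto simp: bij_betw_def induced_def)
  then show False using assms(4) by simp
qed

lemma simple_cycle_graph: "2 \<le> k \<Longrightarrow> simple_graph (cycle_graph k)"
proof -
  assume k: "2 \<le> k"
  have "i \<noteq> (i + 1) mod k" if "i < k" for i
    using that k by (cases "Suc i = k") auto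
  then show ?thesis using k by (auto simp: simple_graph_def cycle_graph_def)
qed

lemma connected_cycle_graph: "connected_graph (cycle_graph k)"
proof -
  have "(0, i) \<in> conn (edges (cycle_graph k))" if "i < k" for i
    using that
  proof (induction i)
    case (Suc i)
    then have "{i, Suc i} \<in> edges (cycle_graph k)"
      unfolding cycle_graph_def by (auto intro!: exI[of _ i])
    with Suc show ?case by (auto intro: conn_trans conn_edge)
  qed simp
  moreover have "verts (cycle_graph k) = {0..<k}" by (simp add: cycle_graph_def)
  ultimately show ?thesis
    unfolding connected_graph_def by (metis atLeastLessThan_iff conn_sym conn_trans)
qed

lemma simple_X_graph: "simple_graph X_graph"
  by (simp add: simple_graph_def X_graph_def)

lemma connected_X_graph: "connected_graph X_graph"
proof -
  have e: "(1, 2) \<in> conn (edges X_graph)" "(2, 3) \<in> conn (edges X_graph)" "(1, 4) \<in> conn (edges X_graph)"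
    "(1, 5) \<in> conn (edges X_graph)" "(5, 6) \<in> conn (edges X_graph)" "(5, 7) \<in> conn (edges X_graph)"
    by (auto intro!: conn_edge simp: X_graph_def insert_commute)
  then have "(1, i) \<in> conn (edges X_graph)" if "i \<in> verts X_graph" for i
    using that conn_trans[OF e(1) e(2)] conn_trans[OF e(4) e(5)] conn_trans[OF e(4) e(6)]
    by (auto simp: X_graph_def)
  then show ?thesis unfolding connected_graph_def by (blast intro: conn_trans conn_sym)
qed

lemma splits_X_free_chordal_bipartite:
  assumes "splits E E'" "(V, E) \<in> X_free_chordal_bipartite"
  shows "(V, E') \<in> X_free_chordal_bipartite"
proof -
  have sub: "E' \<subseteq> E" using assms(1) by (auto simp: splits_def)
  note G = assms(2)[unfolded X_free_chordal_bipartite_def chordal_bipartite_def mem_Collect_eq]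
  have "simple_graph (V, E')" using G sub by (auto simp: simple_graph_def)
  moreover have "bipartite (V, E')"
  proof -
    obtain A B where "A \<union> B = V" "A \<inter> B = {}" "\<forall>e\<in>E. \<exists>a\<in>A. \<exists>b\<in>B. e = {a, b}"
      using G unfolding bipartite_def by auto
    then show ?thesis using sub unfolding bipartite_def by (intro exI[of _ A] exI[of _ B]) auto
  qed
  moreover have "free_of (cycle_graph k) (V, E')" if "k \<ge> 6" for k
    using G that connected_cycle_graph[of k] simple_cycle_graph[of k]
    by (intro splits_free_of[OF assms(1)]) auto
  moreover have "free_of X_graph (V, E')"
    using G connected_X_graph simple_X_graph by (intro splits_free_of[OF assms(1)]) auto
  ultimately show ?thesis by (simp add: X_free_chordal_bipartite_def chordal_bipartite_def)
qed

text \<open>The number of vertices minus the number of components: the least vertex of each component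
  is not counted.\<close>

definition rank :: "nat set \<Rightarrow> nat set set \<Rightarrow> nat" where
  "rank V E = card {v \<in> V. \<exists>u\<in>V. u < v \<and> (u, v) \<in> conn E}"

text \<open>The least vertex of a component of \<open>E'\<close> is not counted. A deleted edge
  joins two components of \<open>E'\<close>, so the larger of their least vertices is counted for
  \<open>E\<close>, and everything counted for \<open>E'\<close> still is.\<close>

lemma splits_rank:
  assumes "splits E E'" "finite V" "\<forall>e\<in>E. e \<subseteq> V \<and> card e = 2"
  shows "rank V E' < rank V E"
proof -
  let ?S = "\<lambda>E. {v \<in> V. \<exists>u\<in>V. u < v \<and> (u, v) \<in> conn E}"
  have sub: "E' \<subseteq> E" using assms(1) by (auto simp: splits_def)
  obtain e where e: "e \<in> E - E'" using assms(1) by (auto simp: splits_def)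
  then obtain u v where uv: "e = {u, v}" using assms(3) by (auto simp: card_2_iff)
  have uvV: "u \<in> V" "v \<in> V" and nc: "(u, v) \<notin> conn E'" and c: "(u, v) \<in> conn E"
    using assms(1,3) e uv by (auto simp: splits_def intro: conn_edge)
  have "\<exists>a\<in>V. (a, w) \<in> conn E' \<and> a \<notin> ?S E'" if "w \<in> V" for w
  proof -
    define a where "a = (LEAST a. a \<in> V \<and> (a, w) \<in> conn E')"
    have a: "a \<in> V \<and> (a, w) \<in> conn E'"
      unfolding a_def by (rule LeastI[of _ w]) (use that in auto)
    have le: "a \<le> b" if "b \<in> V" "(b, w) \<in> conn E'" for b
      unfolding a_def by (rule Least_le) (use that in auto)
    have "\<not> b < a" if "b \<in> V" "(b, a) \<in> conn E'" for b
      using le[OF that(1) conn_trans[OF that(2)]] a by simp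
    then have "a \<notin> ?S E'" by blast
    with a show ?thesis by blast
  qed
  note least = this
  obtain a where a: "a \<in> V" "(a, u) \<in> conn E'" "a \<notin> ?S E'"
    using least[OF uvV(1)] by blast
  obtain b where b: "b \<in> V" "(b, v) \<in> conn E'" "b \<notin> ?S E'"
    using least[OF uvV(2)] by blast
  have "(a, u) \<in> conn E" "(b, v) \<in> conn E" using a b conn_mono[OF sub] by auto
  then have "(a, b) \<in> conn E" using c conn_trans conn_sym by metis
  moreover have "a \<noteq> b" using a b nc conn_trans conn_sym by metis
  ultimately have "a \<in> ?S E \<or> b \<in> ?S E"
    using a b conn_sym[of a b E] by (cases "a < b") auto
  moreover have "?S E' \<subseteq> ?S E" using conn_mono[OF sub] by auto
  ultimately have "?S E' \<subset> ?S E" using a b by blast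
  then show ?thesis unfolding rank_def by (intro psubset_card_mono) (use assms in auto)
qed

section \<open>Irreducible graphs\<close>

locale X_free_chordal_bipartite_graph =
  fixes V :: "nat set" and E :: "nat set set"
  assumes in_class: "(V, E) \<in> X_free_chordal_bipartite"
begin

lemma edge_subset: "e \<in> E \<Longrightarrow> e \<subseteq> V" and edge_card: "e \<in> E \<Longrightarrow> card e = 2"
  and finite_V: "finite V"
  using in_class by (auto simp: X_free_chordal_bipartite_def simple_graph_def)

lemma edge_verts: "{u, v} \<in> E \<Longrightarrow> u \<in> V" "{u, v} \<in> E \<Longrightarrow> v \<in> V"
  using edge_subset by auto

lemma finite_nbrs [simp]: "finite (nbrs E v)"
  by (rule finite_subset[OF _ finite_V]) (auto dest: edge_verts)

text \<open>A 2-colouring fixed once by choice, so that distinctness and non-adjacency become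
  propositional facts about sides.\<close>

definition side :: "nat set" where
  "side = (SOME S. \<forall>u v. {u, v} \<in> E \<longrightarrow> (u \<in> S) \<noteq> (v \<in> S))"

lemma edge_side: "{u, v} \<in> E \<Longrightarrow> u \<in> side \<longleftrightarrow> v \<notin> side"
proof -
  have "bipartite (V, E)"
    using in_class by (simp add: X_free_chordal_bipartite_def chordal_bipartite_def)
  then obtain A B where AB: "A \<inter> B = {}" "\<forall>e\<in>E. \<exists>a\<in>A. \<exists>b\<in>B. e = {a, b}"
    unfolding bipartite_def by auto
  have "(u \<in> A) \<noteq> (v \<in> A)" if uv: "{u, v} \<in> E" for u v
  proof -
    obtain a b where "a \<in> A" "b \<in> B" "{u, v} = {a, b}" using AB(2) uv by blast
    then show ?thesis using AB(1) by (auto simp: doubleton_eq_iff)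
  qed
  then have "\<exists>S. \<forall>u v. {u, v} \<in> E \<longrightarrow> (u \<in> S) \<noteq> (v \<in> S)" by blast
  from someI_ex[OF this] show "{u, v} \<in> E \<Longrightarrow> u \<in> side \<longleftrightarrow> v \<notin> side"
    unfolding side_def by blast
qed

section \<open>Forbidden induced subgraphs in terms of edges and sides\<close>

lemma same_side: "u \<in> side \<longleftrightarrow> v \<in> side \<Longrightarrow> {u, v} \<notin> E"
  using edge_side by blast

text \<open>Pairs \<open>i < j\<close> suffice: symmetry and the absence of loops settle the others,
  and each \<open>g i\<close> lies in \<open>V\<close> because it is an end of an edge.\<close>

lemma no_long_cycle:
  assumes "6 \<le> k" "inj_on g {..<k}"
    and adj: "\<And>i j. i < j \<Longrightarrow> j < k \<Longrightarrow> {g i, g j} \<in> E \<longleftrightarrow> j = Suc i \<or> i = 0 \<and> Suc j = k"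
  shows False
proof -
  have cyc: "{i, j} \<in> edges (cycle_graph k) \<longleftrightarrow> j = Suc i \<or> i = 0 \<and> Suc j = k"
    if ij: "i < j" "j < k" for i j
  proof
    assume "{i, j} \<in> edges (cycle_graph k)"
    then obtain l where l: "l < k" "{i, j} = {l, (l + 1) mod k}" unfolding cycle_graph_def by auto
    show "j = Suc i \<or> i = 0 \<and> Suc j = k"
    proof (cases "Suc l = k")
      case True
      then show ?thesis using l(2) ij by (simp add: doubleton_eq_iff)
    next
      case False
      then have "(l + 1) mod k = Suc l" using l(1) by simp
      then show ?thesis using l(2) ij by (auto simp: doubleton_eq_iff)
    qed
  next
    have edge: "{l, (l + 1) mod k} \<in> edges (cycle_graph k)" if "l < k" for l
      unfolding cycle_graph_def using that by auto
    assume "j = Suc i \<or> i = 0 \<and> Suc j = k"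
    then show "{i, j} \<in> edges (cycle_graph k)"
      using edge[of i] edge[of j] ij by (elim disjE) (simp_all add: insert_commute)
  qed
  have eq: "{i, j} \<in> edges (cycle_graph k) \<longleftrightarrow> {g i, g j} \<in> E" if "i < k" "j < k" for i j
  proof (cases i j rule: linorder_cases)
    case less
    then show ?thesis using cyc adj that by simp
  next
    case greater
    then show ?thesis using cyc[of j i] adj[of j i] that by (simp add: insert_commute)
  next
    case equal
    have "simple_graph (cycle_graph k)" using simple_cycle_graph[of k] assms(1) by simp
    then have "{i, i} \<in> edges (cycle_graph k) \<Longrightarrow> card {i, i} = 2"
      unfolding simple_graph_def by blast
    then have "{i, i} \<notin> edges (cycle_graph k)" by auto
    moreover have "{g i, g i} \<notin> E" using edge_card[of "{g i, g i}"] by auto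
    ultimately show ?thesis using equal by simp
  qed
  have "g i \<in> V" if "i < k" for i
  proof (cases "Suc i < k")
    case True
    then show ?thesis using adj[of i "Suc i"] edge_verts by simp
  next
    case False
    then have "Suc (i - 1) = i" using that assms(1) by simp
    then show ?thesis using adj[of "i - 1" i] edge_verts that by simp
  qed
  note gV = this
  have V: "verts (cycle_graph k) = {..<k}" by (simp add: cycle_graph_def lessThan_atLeast0)
  have "\<not> free_of (cycle_graph k) (V, E)"
  proof (rule not_free_of_embedding)
    show "inj_on g (verts (cycle_graph k))" using assms(2) V by simp
    show "g ` verts (cycle_graph k) \<subseteq> verts (V, E)" using gV V by auto
    show "{a, b} \<in> edges (cycle_graph k) \<longleftrightarrow> {g a, g b} \<in> edges (V, E)"
      if "a \<in> verts (cycle_graph k)" "b \<in> verts (cycle_graph k)" for a b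
      using that eq[of a b] V by simp
  qed
  then show False
    using in_class assms(1) by (simp add: X_free_chordal_bipartite_def chordal_bipartite_def)
qed

text \<open>Beyond the six edges only the three long diagonals matter. The other pairs lie on one
  side, and two vertices of one side differ because some vertex is adjacent to just one of
  them.\<close>

lemma no_hexagon:
  assumes E: "{a, b} \<in> E" "{b, c} \<in> E" "{c, d} \<in> E" "{d, e} \<in> E" "{e, f} \<in> E" "{a, f} \<in> E"
    and nE: "{a, d} \<notin> E" "{b, e} \<notin> E" "{c, f} \<notin> E"
  shows False
proof -
  define g where "g = (!) [a, b, c, d, e, f]"
  have g: "g 0 = a" "g 1 = b" "g (Suc 0) = b" "g 2 = c" "g 3 = d" "g 4 = e" "g 5 = f"
    by (simp_all add: g_def numeral_eq_Suc)
  have s: "a \<in> side \<longleftrightarrow> b \<notin> side" "b \<in> side \<longleftrightarrow> c \<notin> side" "c \<in> side \<longleftrightarrow> d \<notin> side"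
    "d \<in> side \<longleftrightarrow> e \<notin> side" "e \<in> side \<longleftrightarrow> f \<notin> side"
    using E(1-5) edge_side by blast+
  have same: "{a, c} \<notin> E" "{a, e} \<notin> E" "{c, e} \<notin> E" "{b, d} \<notin> E" "{b, f} \<notin> E" "{d, f} \<notin> E"
    by (rule same_side, use s in argo)+
  have "a \<noteq> c" "a \<noteq> e" "c \<noteq> e" "b \<noteq> d" "b \<noteq> f" "d \<noteq> f"
    by (use E nE in \<open>auto simp: insert_commute\<close>)
  moreover have "a \<noteq> b" "a \<noteq> d" "a \<noteq> f" "b \<noteq> c" "c \<noteq> d" "c \<noteq> f" "b \<noteq> e" "d \<noteq> e" "e \<noteq> f"
    by (use s in metis)+
  ultimately have "distinct [a, b, c, d, e, f]" by simp
  then have "inj_on g {..<6}" unfolding g_def by (intro inj_on_nth) auto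
  moreover have "{g i, g j} \<in> E \<longleftrightarrow> j = Suc i \<or> i = 0 \<and> Suc j = 6" if "i < j" "j < 6" for i j
  proof -
    have "i \<in> {0, 1, 2, 3, 4}" "j \<in> {1, 2, 3, 4, 5}" using that by auto
    then show ?thesis using that(1) by (elim insertE emptyE; simp add: g E nE same)
  qed
  ultimately show False using no_long_cycle[of 6 g] by simp
qed

text \<open>Pairs on one side are not adjacent. The two inequalities cannot be derived from
  adjacencies, because \<open>c2\<close>, \<open>c4\<close> and likewise \<open>q\<close>,
  \<open>r\<close> have equal neighbourhoods in the forbidden graph.\<close>

lemma no_X:
  assumes E: "{c1, c2} \<in> E" "{c2, c3} \<in> E" "{c3, c4} \<in> E" "{c4, c1} \<in> E"
      "{c1, p} \<in> E" "{p, q} \<in> E" "{p, r} \<in> E"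
    and nE: "{p, c3} \<notin> E" "{q, c2} \<notin> E" "{q, c4} \<notin> E" "{r, c2} \<notin> E" "{r, c4} \<notin> E"
    and neq: "c2 \<noteq> c4" "q \<noteq> r"
  shows False
proof -
  \<comment> \<open>The first entry is a filler, since the vertices of \<open>X_graph\<close> are
    numbered from 1.\<close>
  define g where "g = (!) [c1, c1, c2, c3, c4, p, q, r]"
  have g: "g 1 = c1" "g (Suc 0) = c1" "g 2 = c2" "g 3 = c3" "g 4 = c4" "g 5 = p" "g 6 = q" "g 7 = r"
    by (simp_all add: g_def numeral_eq_Suc)
  have s: "c1 \<in> side \<longleftrightarrow> c2 \<notin> side" "c2 \<in> side \<longleftrightarrow> c3 \<notin> side" "c3 \<in> side \<longleftrightarrow> c4 \<notin> side"
    "c1 \<in> side \<longleftrightarrow> p \<notin> side" "p \<in> side \<longleftrightarrow> q \<notin> side" "p \<in> side \<longleftrightarrow> r \<notin> side"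
    using E edge_side by blast+
  have ne1: "c1 \<noteq> c3" "c1 \<noteq> q" "c1 \<noteq> r" "c3 \<noteq> q" "c3 \<noteq> r" "c2 \<noteq> p" "c4 \<noteq> p"
    by (use E nE in \<open>auto simp: insert_commute\<close>)
  have ne2: "c1 \<noteq> c2" "c1 \<noteq> c4" "c1 \<noteq> p" "c2 \<noteq> c3" "c3 \<noteq> c4" "c3 \<noteq> p"
    "c2 \<noteq> q" "c4 \<noteq> q" "p \<noteq> q" "c2 \<noteq> r" "c4 \<noteq> r" "p \<noteq> r"
    by (use s in metis)+
  have same: "{c1, c1} \<notin> E" "{c2, c2} \<notin> E" "{c3, c3} \<notin> E" "{c4, c4} \<notin> E" "{p, p} \<notin> E"
    "{q, q} \<notin> E" "{r, r} \<notin> E" "{c1, c3} \<notin> E" "{c1, q} \<notin> E" "{c1, r} \<notin> E" "{c3, q} \<notin> E"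
    "{c3, r} \<notin> E" "{q, r} \<notin> E" "{c2, c4} \<notin> E" "{c2, p} \<notin> E" "{c4, p} \<notin> E"
    by (rule same_side, use s in argo)+
  note adj = E nE same[simplified]
  have adj': "{c2, c1} \<in> E" "{c3, c2} \<in> E" "{c4, c3} \<in> E" "{c1, c4} \<in> E"
      "{p, c1} \<in> E" "{q, p} \<in> E" "{r, p} \<in> E"
    "{c3, p} \<notin> E" "{c2, q} \<notin> E" "{c4, q} \<notin> E" "{c2, r} \<notin> E" "{c4, r} \<notin> E"
    "{c3, c1} \<notin> E" "{q, c1} \<notin> E" "{r, c1} \<notin> E" "{q, c3} \<notin> E"
    "{r, c3} \<notin> E" "{r, q} \<notin> E" "{c4, c2} \<notin> E" "{p, c2} \<notin> E" "{p, c4} \<notin> E"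
    using E nE same by (simp_all add: insert_commute)
  have V: "verts X_graph = {1, 2, 3, 4, 5, 6, 7}" by (simp add: X_graph_def)
  have "distinct [c1, c2, c3, c4, p, q, r]" using ne1 ne2 neq by simp
  then have "inj_on g (verts X_graph)"
    unfolding V inj_on_def by (simp add: g) blast
  moreover have "g ` verts X_graph \<subseteq> V"
    unfolding V using E by (simp add: g edge_verts[OF E(1)] edge_verts[OF E(3)] edge_verts[OF E(6)] edge_verts[OF E(7)])
  moreover have "{a, b} \<in> edges X_graph \<longleftrightarrow> {g a, g b} \<in> E"
    if "a \<in> verts X_graph" "b \<in> verts X_graph" for a b
    using that unfolding V
    by (elim insertE emptyE; simp add: X_graph_def g doubleton_eq_iff adj adj')
  ultimately have "\<not> free_of X_graph (V, E)" by (intro not_free_of_embedding) auto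
  then show False using in_class by (simp add: X_free_chordal_bipartite_def)
qed

end

section \<open>The structure around a vertex of large degree\<close>

lemma two_le_cardE:
  assumes "2 \<le> card A" obtains x y where "x \<in> A" "y \<in> A" "x \<noteq> y"
proof -
  obtain B where "B \<subseteq> A" "card B = 2" using obtain_subset_with_card_n[OF assms] by blast
  then show ?thesis using that by (auto simp: card_2_iff)
qed

text \<open>The situation at a vertex of maximum degree when there are no vertices of low degree and
  no near twins. Each assumption supplies the two leaves of a forbidden graph:
  \<open>private_nbrs\<close> at \<open>p\<close>, \<open>min_degree\<close> at a vertex at distance
  three from \<open>p\<close>.\<close>

locale spread_vertex = X_free_chordal_bipartite_graph +
  fixes p
  assumes private_nbrs: "x \<noteq> p \<Longrightarrow> {x, w} \<in> E \<Longrightarrow> {p, w} \<in> E \<Longrightarrow> 2 \<le> card (nbrs E p - nbrs E x)"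
    and min_degree: "{v, w} \<in> E \<Longrightarrow> 3 \<le> card (nbrs E v)"
begin

text \<open>If all common neighbours of \<open>x\<close> and \<open>p\<close> are adjacent to
  \<open>y\<close>, then the 4-cycle \<open>b x w y\<close>, with \<open>p\<close> hanging at
  \<open>b\<close> and two neighbours of \<open>p\<close> missed by \<open>y\<close> as leaves, is
  forbidden; likewise with \<open>x\<close> and \<open>y\<close> exchanged. Otherwise
  \<open>p b' x w y c'\<close> is an induced hexagon.\<close>

lemma second_level_disjoint:
  assumes "x \<noteq> p" "y \<noteq> p" "x \<noteq> y"
    and xb: "{x, b} \<in> E" "{p, b} \<in> E" and yc: "{y, c} \<in> E" "{p, c} \<in> E"
    and w: "{x, w} \<in> E" "{y, w} \<in> E"
  shows "{p, w} \<in> E"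
proof (rule ccontr)
  assume pw: "{p, w} \<notin> E"
  have nested: False
    if xy: "x \<noteq> p" "y \<noteq> p" "x \<noteq> y" "{x, b} \<in> E" "{p, b} \<in> E" "{x, w} \<in> E" "{y, w} \<in> E"
      and sub: "\<And>b. {x, b} \<in> E \<Longrightarrow> {p, b} \<in> E \<Longrightarrow> {y, b} \<in> E" for x y b
  proof -
    have yb: "{y, b} \<in> E" using xy sub by blast
    obtain q r where "q \<noteq> r" "q \<in> nbrs E p - nbrs E y" "r \<in> nbrs E p - nbrs E y"
      using two_le_cardE[OF private_nbrs[OF xy(2) yb xy(5)]] by blast
    then have qr: "q \<noteq> r" "{p, q} \<in> E" "{p, r} \<in> E" "{y, q} \<notin> E" "{y, r} \<notin> E" by auto
    then have "{x, q} \<notin> E" "{x, r} \<notin> E" using sub by blast+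
    then show False
      using no_X[of b x w y p q r] qr xy yb pw by (simp add: insert_commute)
  qed
  obtain b' where b': "{x, b'} \<in> E" "{p, b'} \<in> E" "{y, b'} \<notin> E"
    using nested[of x y b] assms by blast
  obtain c' where c': "{y, c'} \<in> E" "{p, c'} \<in> E" "{x, c'} \<notin> E"
    using nested[of y x c] assms by blast
  show False using no_hexagon[of p b' x w y c'] b' c' w pw by (simp add: insert_commute)
qed

text \<open>Two different such neighbours give the 4-cycle \<open>x b p c\<close>, with
  \<open>w\<close> hanging at \<open>x\<close> and two further neighbours of \<open>w\<close> as
  leaves.\<close>

lemma unique_first_level_nbr:
  assumes "x \<noteq> p" and w: "{x, w} \<in> E" "{p, w} \<notin> E"
    and b: "{x, b} \<in> E" "{p, b} \<in> E" and c: "{x, c} \<in> E" "{p, c} \<in> E"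
  shows "b = c"
proof (rule ccontr)
  assume "b \<noteq> c"
  have "{w, x} \<in> E" using w by (simp add: insert_commute)
  then have "2 \<le> card (nbrs E w - {x})"
    using min_degree[of w x] by (simp add: card_Diff_singleton)
  then obtain q r where "q \<noteq> r" "q \<in> nbrs E w - {x}" "r \<in> nbrs E w - {x}"
    by (rule two_le_cardE) blast
  then have qr: "q \<noteq> r" "{w, q} \<in> E" "{w, r} \<in> E" "q \<noteq> x" "r \<noteq> x" by auto
  \<comment> \<open>Otherwise \<open>z\<close> would be a second vertex at distance two from
    \<open>p\<close> sharing \<open>w\<close> with \<open>x\<close>.\<close>
  have non: "{z, d} \<notin> E" if "{w, z} \<in> E" "z \<noteq> x" "{p, d} \<in> E" for z d
  proof
    assume "{z, d} \<in> E"
    moreover have "z \<noteq> p" using that w by (auto simp: insert_commute)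
    ultimately show False
      using second_level_disjoint[of x z b d w] assms that by (simp add: insert_commute)
  qed
  show False
    using no_X[of x b p c w q r] non[OF qr(2,4)] non[OF qr(3,5)] qr assms \<open>b \<noteq> c\<close>
    by (simp add: insert_commute)
qed

text \<open>The core is closed up to \<open>rim\<close>: an edge leaves it only from a neighbour of
  \<open>p\<close> to a rim vertex.\<close>

definition core :: "nat set" where
  "core = {z. z = p \<or> {p, z} \<in> E \<or> nbrs E z \<inter> nbrs E p \<noteq> {} \<and> nbrs E z \<subseteq> nbrs E p}"

definition rim :: "nat set" where
  "rim = {z. z \<noteq> p \<and> nbrs E z \<inter> nbrs E p \<noteq> {} \<and> \<not> nbrs E z \<subseteq> nbrs E p}"

lemma rim_core: "z \<in> rim \<Longrightarrow> z \<notin> core"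
proof
  assume z: "z \<in> rim" "z \<in> core"
  then obtain b where b: "{z, b} \<in> E" "{p, b} \<in> E" by (auto simp: rim_def)
  then have "{p, z} \<notin> E" using edge_side by blast
  with z show False by (auto simp: rim_def core_def)
qed

lemma core_boundary:
  assumes "{z, z'} \<in> E" "z \<in> core" "z' \<notin> core" shows "{p, z} \<in> E \<and> z' \<in> rim"
proof -
  have z'z: "{z', z} \<in> E" using assms(1) by (simp add: insert_commute)
  have "{p, z} \<in> E" using assms by (auto simp: core_def)
  then show ?thesis using assms(3) z'z by (auto simp: core_def rim_def)
qed

lemma rim_nbr:
  assumes "z \<in> rim" obtains b where "{z, b} \<in> E" "{p, b} \<in> E"
    "\<And>c. {z, c} \<in> E \<Longrightarrow> {p, c} \<in> E \<Longrightarrow> c = b"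
proof -
  obtain b w where "{z, b} \<in> E" "{p, b} \<in> E" "{z, w} \<in> E" "{p, w} \<notin> E" "z \<noteq> p"
    using assms by (auto simp: rim_def)
  then show ?thesis using that unique_first_level_nbr[of z w _ b] by blast
qed

definition outer :: "(nat \<times> nat) set" where
  "outer = {(u, v). {u, v} \<in> E \<and> u \<notin> core \<and> v \<notin> core}"

lemma relpow_path_segment:
  assumes "\<forall>i<m. (f i, f (Suc i)) \<in> R" "i \<le> j" "j \<le> m"
  shows "(f i, f j) \<in> R ^^ (j - i)"
  unfolding relpow_fun_conv
  by (rule exI[of _ "\<lambda>k. f (i + k)"]) (use assms in auto)

text \<open>A shortest path between two rim vertices outside the core would close up through
  the core to a long induced cycle.\<close>

lemma rim_separated:
  assumes "x \<in> rim" "y \<in> rim" "x \<noteq> y" shows "(x, y) \<notin> outer\<^sup>*"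
proof
  assume "(x, y) \<in> outer\<^sup>*"
  \<comment> \<open>The minimum is taken over all pairs of distinct rim vertices, so that a shortest
    path has no rim vertex in its interior.\<close>
  define P where "P m \<longleftrightarrow> (\<exists>x y. x \<in> rim \<and> y \<in> rim \<and> x \<noteq> y \<and> (x, y) \<in> outer ^^ m)" for m
  obtain k where "(x, y) \<in> outer ^^ k"
    using rtrancl_imp_relpow[OF \<open>(x, y) \<in> outer\<^sup>*\<close>] by blast
  then have "P k" using assms unfolding P_def by blast
  define m where "m = (LEAST m. P m)"
  have "P m" unfolding m_def by (rule LeastI[where P = P, OF \<open>P k\<close>])
  have least: "m \<le> k" if "P k" for k unfolding m_def by (rule Least_le[where P = P, OF that])
  obtain x y f where x: "x \<in> rim" and y: "y \<in> rim" and "x \<noteq> y"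
    and f: "f 0 = x" "f m = y" and path: "\<forall>i<m. (f i, f (Suc i)) \<in> outer"
    using \<open>P m\<close> unfolding P_def relpow_fun_conv by auto
  \<comment> \<open>Splicing a shorter connection into the path would contradict minimality. Length
    0 gives injectivity, length 1 the absence of chords.\<close>
  have shortest: "j - i \<le> k" if "i \<le> j" "j \<le> m" "(f i, f j) \<in> outer ^^ k" for i j k
  proof -
    have "(x, f i) \<in> outer ^^ i" "(f j, y) \<in> outer ^^ (m - j)"
      using relpow_path_segment[OF path, of 0 i] relpow_path_segment[OF path, of j m] f that by auto
    then have "(x, y) \<in> outer ^^ (i + k + (m - j))"
      using that(3) unfolding relpow_add by blast
    then have "m \<le> i + k + (m - j)" using x y \<open>x \<noteq> y\<close> by (intro least) (auto simp: P_def)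
    then show ?thesis using that by linarith
  qed
  have f_core: "f i \<notin> core" if "i \<le> m" for i
    using that path rim_core[OF x] f by (cases i) (auto simp: outer_def)
  have f_inj: "f i \<noteq> f j" if "i < j" "j \<le> m" for i j
    using shortest[of i j 0] that by auto
  have f_adj: "{f i, f j} \<in> E \<longleftrightarrow> j = Suc i" if "i < j" "j \<le> m" for i j
  proof
    assume "{f i, f j} \<in> E"
    then have "(f i, f j) \<in> outer ^^ 1" using f_core that by (simp add: outer_def)
    then show "j = Suc i" using shortest[of i j 1] that by simp
  next
    assume "j = Suc i"
    then show "{f i, f j} \<in> E" using path that by (auto simp: outer_def)
  qed
  have f_rim: "i = 0 \<or> i = m" if "f i \<in> rim" "i \<le> m" for i
  proof (rule ccontr)
    assume i: "\<not> (i = 0 \<or> i = m)"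
    then have "f 0 \<noteq> f i" using f_inj[of 0 i] that by simp
    moreover have "(f 0, f i) \<in> outer ^^ i" using relpow_path_segment[OF path, of 0 i] that by simp
    ultimately have "P i" using x f that by (auto simp: P_def)
    then show False using least[of i] that i by simp
  qed
  have f_side: "f i \<in> side \<longleftrightarrow> (x \<in> side \<longleftrightarrow> even i)" if "i \<le> m" for i
    using that
  proof (induction i)
    case (Suc i)
    then show ?case using f_adj[of i "Suc i"] edge_side[of "f i" "f (Suc i)"] by auto
  qed (use f in simp)
  obtain b where b: "{x, b} \<in> E" "{p, b} \<in> E"
    and b_unique: "\<And>c. {x, c} \<in> E \<Longrightarrow> {p, c} \<in> E \<Longrightarrow> c = b" using rim_nbr[OF x] by blast
  obtain c where c: "{y, c} \<in> E" "{p, c} \<in> E"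
    and c_unique: "\<And>b. {y, b} \<in> E \<Longrightarrow> {p, b} \<in> E \<Longrightarrow> b = c" using rim_nbr[OF y] by blast
  have sides: "x \<in> side \<longleftrightarrow> b \<notin> side" "p \<in> side \<longleftrightarrow> b \<notin> side" "y \<in> side \<longleftrightarrow> c \<notin> side" "p \<in> side \<longleftrightarrow> c \<notin> side"
    using b c edge_side by blast+
  \<comment> \<open>Both ends lie on the side of \<open>p\<close>. Once lengths 0 and 2 are
    excluded, the path is long enough to close to a cycle of length at least six.\<close>
  have "even m" using f_side[of m] f sides by auto
  moreover have "m \<noteq> 0" using f \<open>x \<noteq> y\<close> by metis
  moreover have "m \<noteq> 2"
  proof
    assume "m = 2"
    then have "{x, f 1} \<in> E" "{y, f 1} \<in> E" "f 1 \<notin> core"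
      using f_adj[of 0 1] f_adj[of 1 2] f f_core[of 1] by (auto simp: insert_commute)
    then show False
      using second_level_disjoint[of x y b c "f 1"] b c x y \<open>x \<noteq> y\<close> by (auto simp: rim_def core_def)
  qed
  ultimately have "4 \<le> m" by presburger
  \<comment> \<open>Neighbours of \<open>p\<close> attach to the path only at its ends, where they
    must be \<open>b\<close> and \<open>c\<close>.\<close>
  have f_first: "i = 0 \<and> z = b \<or> i = m \<and> z = c" if "{f i, z} \<in> E" "{p, z} \<in> E" "i \<le> m" for i z
  proof -
    have "f i \<in> rim"
      using core_boundary[of z "f i"] that f_core[of i] by (auto simp: core_def insert_commute)
    then have "i = 0 \<or> i = m" using f_rim that by blast
    then show ?thesis using that f b_unique c_unique by auto
  qed
  have core: "p \<in> core" "b \<in> core" "c \<in> core" using b c by (auto simp: core_def)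
  have f_ne: "f i \<noteq> p" "f i \<noteq> b" "f i \<noteq> c" "{f i, p} \<notin> E" if "i \<le> m" for i
    using f_core[OF that] core by (auto simp: core_def insert_commute)
  show False
  \<comment> \<open>The cycle is closed through the common vertex \<open>b\<close>, with length
    \<open>m + 2\<close>, or through \<open>c\<close>, \<open>p\<close>, \<open>b\<close>, with
    length \<open>m + 4\<close>.\<close>
  proof (cases "b = c")
    case True
    have fb: "{f i, b} \<in> E \<longleftrightarrow> i = 0 \<or> i = m" if "i \<le> m" for i
      using f_first[of i b] b c f True that by auto
    define g where "g i = (if i \<le> m then f i else b)" for i
    have "g i \<noteq> g j" if "i < j" "j < m + 2" for i j
      using f_inj[of i j] that f_ne[of i] by (cases "j \<le> m") (auto simp: g_def)
    then have "inj_on g {..<m + 2}"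
      unfolding inj_on_def by (metis lessThan_iff linorder_neqE_nat)
    moreover have "{g i, g j} \<in> E \<longleftrightarrow> j = Suc i \<or> i = 0 \<and> Suc j = m + 2"
      if "i < j" "j < m + 2" for i j
    proof (cases "j \<le> m")
      case True
      then show ?thesis using f_adj[of i j] that by (simp add: g_def)
    next
      case False
      then have "j = m + 1" using that by simp
      then show ?thesis using fb[of i] that by (auto simp: g_def)
    qed
    ultimately show False using no_long_cycle[of "m + 2" g] \<open>4 \<le> m\<close> by simp
  next
    case False
    have fb: "{f i, b} \<in> E \<longleftrightarrow> i = 0" and fc: "{f i, c} \<in> E \<longleftrightarrow> i = m" if "i \<le> m" for i
      using f_first[of i b] f_first[of i c] b c f False that by auto
    have ne: "b \<noteq> p" "c \<noteq> p" "{c, b} \<notin> E" using sides by (auto intro!: same_side)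
    define g where "g i = (if i \<le> m then f i else if i = m + 1 then c else if i = m + 2 then p else b)" for i
    have "g i \<noteq> g j" if ij: "i < j" "j < m + 4" for i j
    proof -
      consider "j \<le> m" | "i \<le> m" "j = m + 1 \<or> j = m + 2 \<or> j = m + 3"
        | "i = m + 1" "j = m + 2" | "i = m + 1" "j = m + 3" | "i = m + 2" "j = m + 3"
        using ij by linarith
      then show ?thesis
        using f_inj[of i j] that f_ne[of i] ne False by cases (auto simp: g_def)
    qed
    then have "inj_on g {..<m + 4}"
      unfolding inj_on_def by (metis lessThan_iff linorder_neqE_nat)
    moreover have "{g i, g j} \<in> E \<longleftrightarrow> j = Suc i \<or> i = 0 \<and> Suc j = m + 4"
      if ij: "i < j" "j < m + 4" for i j
    proof -
      consider "j \<le> m" | "i \<le> m" "j = m + 1" | "i \<le> m" "j = m + 2" | "i \<le> m" "j = m + 3"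
        | "i = m + 1" "j = m + 2" | "i = m + 1" "j = m + 3" | "i = m + 2" "j = m + 3"
        using ij by linarith
      then show ?thesis
        using f_adj[of i j] that fb[of i] fc[of i] f_ne(4)[of i] ne b(2) c(2) \<open>4 \<le> m\<close>
        by cases (auto simp: g_def insert_commute)
    qed
    ultimately show False using no_long_cycle[of "m + 4" g] \<open>4 \<le> m\<close> by simp
  qed
qed

text \<open>A walk from \<open>x\<close> avoiding the edge never enters the core. It could enter
  only from a rim vertex, which is \<open>x\<close> by \<open>rim_separated\<close>, and the only
  edge from \<open>x\<close> to a neighbour of \<open>p\<close> is the avoided one.\<close>

lemma rim_bridge:
  assumes x: "x \<in> rim" and b: "{x, b} \<in> E" "{p, b} \<in> E"
  shows "(x, b) \<notin> conn (E - {{x, b}})"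
proof
  assume "(x, b) \<in> conn (E - {{x, b}})"
  then have "b \<notin> core \<and> (x, b) \<in> outer\<^sup>*"
    unfolding conn_def
  proof (induction rule: rtrancl_induct)
    case (step z z')
    then have zz': "{z, z'} \<in> E" "{z', z} \<in> E" "{z, z'} \<noteq> {x, b}" by (auto simp: insert_commute)
    have "z' \<notin> core"
    proof
      assume "z' \<in> core"
      then have "{p, z'} \<in> E" "z \<in> rim" using core_boundary zz' step.IH by blast+
      then have "z = x" using rim_separated[OF x] step.IH by blast
      then have "z' = b" using rim_nbr[OF x] b zz' \<open>{p, z'} \<in> E\<close> by metis
      then show False using zz' \<open>z = x\<close> by simp
    qed
    then show ?case using step.IH zz' by (auto simp: outer_def intro: rtrancl_into_rtrancl)
  qed (use rim_core[OF x] in simp)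
  then show False using b by (auto simp: core_def)
qed

text \<open>A rim vertex yields a bridge. Without a rim no edge leaves the core, so \<open>p\<close>
  is adjacent to the whole opposite side of its component; \<open>closed\<close> is the local form
  of this.\<close>

lemma bridge_or_closed:
  obtains (bridge) x b where "{x, b} \<in> E" "(x, b) \<notin> conn (E - {{x, b}})"
  | (closed) "\<And>x w z. {x, w} \<in> E \<Longrightarrow> {p, w} \<in> E \<Longrightarrow> {x, z} \<in> E \<Longrightarrow> {p, z} \<in> E"
proof (cases "rim = {}")
  case True
  have "nbrs E x \<subseteq> nbrs E p" if "{x, w} \<in> E" "{p, w} \<in> E" for x w
  proof (rule ccontr)
    assume "\<not> nbrs E x \<subseteq> nbrs E p"
    then have "x \<in> rim" using that by (auto simp: rim_def)
    then show False using True by simp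
  qed
  then show thesis by (intro closed) (meson nbrs_iff subsetD)
next
  case False
  then obtain x where x: "x \<in> rim" by blast
  then obtain b where "{x, b} \<in> E" "{p, b} \<in> E" using rim_nbr by blast
  then show thesis using bridge rim_bridge[OF x] by blast
qed

end

section \<open>Moves that restore deleted edges\<close>

definition link :: "'a \<Rightarrow> 'a set \<Rightarrow> 'a set set \<Rightarrow> 'a set set" where
  "link v W E = E \<union> (\<lambda>w. {v, w}) ` W"

definition isolate :: "'a \<Rightarrow> 'a set set \<Rightarrow> 'a set set" where
  "isolate v E = {e \<in> E. v \<notin> e}"

text \<open>The choice \<open>a = b\<close> covers a vertex of degree one and the restoration of a
  single bridge.\<close>

definition link_two :: "'a \<times> 'a \<times> 'a \<Rightarrow> 'a set set \<Rightarrow> 'a set set" where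
  "link_two = (\<lambda>(v, a, b) E. link v {a, b} E)"

definition link_twin :: "'a \<times> 'a \<times> 'a \<times> 'a \<Rightarrow> 'a set set \<Rightarrow> 'a set set" where
  "link_twin = (\<lambda>(v, y, a, b) E. link v (insert b (nbrs E y - {a})) E)"

text \<open>In a bipartite graph these are the vertices at distance zero or two from
  \<open>q\<close>, so two parameters describe a neighbourhood of any size.\<close>

definition link_dominating :: "'a \<times> 'a \<Rightarrow> 'a set set \<Rightarrow> 'a set set" where
  "link_dominating = (\<lambda>(p, q) E. link p (insert q (\<Union>t\<in>nbrs E q. nbrs E t)) E)"

text \<open>\<open>id\<close> makes it possible to pad a short sequence of moves. The other moves
  are given by at most four vertices, so their number is polynomial.\<close>

definition moves :: "'a set \<Rightarrow> ('a set set \<Rightarrow> 'a set set) set" where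
  "moves V = insert id (link_two ` (V \<times> V \<times> V) \<union> link_twin ` (V \<times> V \<times> V \<times> V)
     \<union> link_dominating ` (V \<times> V))"

lemma finite_moves: "finite V \<Longrightarrow> finite (moves V)"
  by (simp add: moves_def)

lemma card_moves:
  assumes "finite V" "V \<noteq> {}" shows "card (moves V) \<le> 4 * card V ^ 4"
proof -
  have "card V > 0" using assms by (simp add: card_gt_0_iff)
  then have "1 \<le> card V ^ 4" "card V ^ 2 \<le> card V ^ 4" "card V ^ 3 \<le> card V ^ 4"
    by (simp_all add: power_increasing)
  then have "1 + card V ^ 3 + card V ^ 4 + card V ^ 2 \<le> 4 * card V ^ 4" by linarith
  moreover have "card (link_two ` (V \<times> V \<times> V)) \<le> card V ^ 3"
    using card_image_le[of "V \<times> V \<times> V" link_two] assms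
    by (simp add: card_cartesian_product power3_eq_cube mult.assoc)
  moreover have "card (link_twin ` (V \<times> V \<times> V \<times> V)) \<le> card V ^ 4"
    using card_image_le[of "V \<times> V \<times> V \<times> V" link_twin] assms
    by (simp add: card_cartesian_product power4_eq_xxxx mult.assoc)
  moreover have "card (link_dominating ` (V \<times> V)) \<le> card V ^ 2"
    using card_image_le[of "V \<times> V" link_dominating] assms
    by (simp add: card_cartesian_product power2_eq_square)
  moreover have "card (moves V) \<le> 1 + (card (link_two ` (V \<times> V \<times> V))
      + card (link_twin ` (V \<times> V \<times> V \<times> V)) + card (link_dominating ` (V \<times> V)))"
    unfolding moves_def
    using card_Un_le[of "link_two ` (V \<times> V \<times> V) \<union> link_twin ` (V \<times> V \<times> V \<times> V)" "link_dominating ` (V \<times> V)"]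
      card_Un_le[of "link_two ` (V \<times> V \<times> V)" "link_twin ` (V \<times> V \<times> V \<times> V)"]
      card_insert_le_m1[of _ "link_two ` (V \<times> V \<times> V) \<union> link_twin ` (V \<times> V \<times> V \<times> V) \<union> link_dominating ` (V \<times> V)" id]
      assms
    by (simp add: card_insert_if)
  ultimately show ?thesis by linarith
qed

lemma conn_isolate: "(v, w) \<in> conn (isolate v E) \<Longrightarrow> w = v"
  unfolding conn_def by (induction rule: rtrancl_induct) (auto simp: isolate_def)

context X_free_chordal_bipartite_graph
begin

text \<open>Every deleted edge contains \<open>v\<close>, which is alone in its component
  afterwards. The given edge makes the inclusion strict.\<close>

lemma splits_isolate:
  assumes "{v, w} \<in> E" shows "splits E (isolate v E)"
  unfolding splits_def
proof (intro conjI allI impI)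
  show "isolate v E \<subset> E" using assms by (auto simp: isolate_def)
  fix a b assume "{a, b} \<in> E - isolate v E"
  then have "{a, b} \<in> E" "v = a \<or> v = b" by (auto simp: isolate_def)
  moreover from this have "a \<noteq> b" using edge_side by blast
  ultimately show "(a, b) \<notin> conn (isolate v E)"
    using conn_isolate conn_sym by metis
qed

lemma splits_bridge:
  assumes "{x, b} \<in> E" "(x, b) \<notin> conn (E - {{x, b}})" shows "splits E (E - {{x, b}})"
  unfolding splits_def
proof (intro conjI allI impI)
  show "E - {{x, b}} \<subset> E" using assms by auto
  fix u v assume "{u, v} \<in> E - (E - {{x, b}})"
  then have "u = x \<and> v = b \<or> u = b \<and> v = x" by (auto simp: doubleton_eq_iff)
  then show "(u, v) \<notin> conn (E - {{x, b}})" using assms(2) conn_sym by metis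
qed

lemma link_isolate:
  assumes "nbrs E v = W" shows "link v W (isolate v E) = E"
proof
  show "link v W (isolate v E) \<subseteq> E"
    using assms by (auto simp: link_def isolate_def)
  show "E \<subseteq> link v W (isolate v E)"
  proof
    fix e assume e: "e \<in> E"
    show "e \<in> link v W (isolate v E)"
    proof (cases "v \<in> e")
      case True
      then obtain w where "e = {v, w}"
        using edge_card[OF e] unfolding card_2_iff by (metis empty_iff insertE insert_commute)
      then show ?thesis using e assms by (auto simp: link_def)
    qed (use e in \<open>simp add: link_def isolate_def\<close>)
  qed
qed

lemma nbrs_isolate: "{v, w} \<in> isolate p E \<longleftrightarrow> {v, w} \<in> E \<and> v \<noteq> p \<and> w \<noteq> p"
  by (auto simp: isolate_def)

lemma two_nbrs:
  assumes "{v, w} \<in> E" "card (nbrs E v) \<le> 2" obtains a b where "nbrs E v = {a, b}"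
proof -
  have "card (nbrs E v) \<noteq> 0" using assms(1) by (auto simp: card_eq_0_iff)
  then have "card (nbrs E v) = 1 \<or> card (nbrs E v) = 2" using assms(2) by linarith
  then show thesis
  proof
    assume "card (nbrs E v) = 1"
    then obtain a where "nbrs E v = {a}" by (auto simp: card_1_singleton_iff)
    then show thesis using that[of a a] by simp
  qed (use that in \<open>auto simp: card_2_iff\<close>)
qed

lemma twin_nbrs:
  assumes "x \<noteq> p" "{x, w} \<in> E" "{p, w} \<in> E"
    and "card (nbrs E p - nbrs E x) \<le> 1" "card (nbrs E x - nbrs E p) \<le> 1"
  obtains a b where "a \<in> V" "b \<in> V" "nbrs E x = insert b (nbrs E p - {a})"
proof -
  have "\<exists>a\<in>V. nbrs E p \<inter> nbrs E x = nbrs E p - {a}"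
  proof (cases "nbrs E p - nbrs E x = {}")
    case True
    \<comment> \<open>With nothing to remove, \<open>x\<close> serves as \<open>a\<close>: it shares
      a neighbour with \<open>p\<close> and so is not adjacent to \<open>p\<close>.\<close>
    have "{p, x} \<notin> E" using assms edge_side by blast
    then have "nbrs E p \<inter> nbrs E x = nbrs E p - {x}" using True by auto
    then show ?thesis using edge_verts(1)[OF assms(2)] by blast
  next
    case False
    then have "card (nbrs E p - nbrs E x) = 1"
      using assms(4) by (simp add: le_Suc_eq)
    then obtain a where a: "nbrs E p - nbrs E x = {a}" by (auto simp: card_1_singleton_iff)
    then have "{p, a} \<in> E" by auto
    then show ?thesis using a edge_verts by blast
  qed
  moreover have "\<exists>b\<in>V. nbrs E x = insert b (nbrs E p \<inter> nbrs E x)"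
  proof (cases "nbrs E x - nbrs E p = {}")
    case True
    \<comment> \<open>With nothing to add, the common neighbour \<open>w\<close> is inserted
      again.\<close>
    then have "nbrs E x = insert w (nbrs E p \<inter> nbrs E x)" using assms(2,3) by auto
    then show ?thesis using edge_verts(2)[OF assms(2)] by blast
  next
    case False
    then have "card (nbrs E x - nbrs E p) = 1"
      using assms(5) by (simp add: le_Suc_eq)
    then obtain b where b: "nbrs E x - nbrs E p = {b}" by (auto simp: card_1_singleton_iff)
    then have "{x, b} \<in> E" by auto
    then show ?thesis using b edge_verts by blast
  qed
  ultimately show thesis using that by metis
qed

lemma finite_maximum:
  fixes f :: "'b \<Rightarrow> nat"
  assumes "finite A" "A \<noteq> {}" obtains a where "a \<in> A" "\<And>b. b \<in> A \<Longrightarrow> f b \<le> f a"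
proof -
  have "Max (f ` A) \<in> f ` A" using assms by simp
  then obtain a where "a \<in> A" "f a = Max (f ` A)" by auto
  then show thesis using that assms(1) by auto
qed

text \<open>Vertices of low degree and near twins are isolated. In the remaining case
  \<open>bridge_or_closed\<close> is applied to \<open>p\<close> and then to its neighbour
  \<open>q\<close>: either a bridge is deleted, or \<open>q\<close> determines the neighbourhood of
  \<open>p\<close> and \<open>p\<close> is isolated.\<close>

lemma exists_move:
  assumes "E \<noteq> {}"
  shows "\<exists>E' m. splits E E' \<and> m \<in> moves V \<and> E = m E'"
proof -
  consider (low_degree) v w where "{v, w} \<in> E" "card (nbrs E v) \<le> 2"
    | (twins) x p w where "x \<noteq> p" "{x, w} \<in> E" "{p, w} \<in> E"
        "card (nbrs E p - nbrs E x) \<le> 1" "card (nbrs E x - nbrs E p) \<le> 1"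
    | (irreducible) "\<And>v w. {v, w} \<in> E \<Longrightarrow> 3 \<le> card (nbrs E v)"
        "\<And>x p w. x \<noteq> p \<Longrightarrow> {x, w} \<in> E \<Longrightarrow> {p, w} \<in> E \<Longrightarrow> card (nbrs E p - nbrs E x) \<le> 1 \<Longrightarrow>
          1 < card (nbrs E x - nbrs E p)"
    by (metis not_le numeral_2_eq_2 numeral_3_eq_3 not_less_eq_eq)
  then show ?thesis
  proof cases
    case low_degree
    obtain a b where ab: "nbrs E v = {a, b}" using two_nbrs low_degree by blast
    then have "{v, a} \<in> E" "{v, b} \<in> E" by (auto simp flip: nbrs_iff)
    then have "link_two (v, a, b) \<in> moves V" using edge_verts unfolding moves_def by blast
    moreover have "E = link_two (v, a, b) (isolate v E)"
      using link_isolate[OF ab] by (simp add: link_two_def)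
    ultimately show ?thesis using splits_isolate[OF low_degree(1)] by blast
  next
    case twins
    obtain a b where ab: "a \<in> V" "b \<in> V" "nbrs E x = insert b (nbrs E p - {a})"
      using twin_nbrs[OF twins] by blast
    have "link_twin (x, p, a, b) \<in> moves V"
      using ab edge_verts(1)[OF twins(2)] edge_verts(1)[OF twins(3)] unfolding moves_def by blast
    \<comment> \<open>The move reads the neighbourhood of \<open>p\<close> after the deletion, so it
      matters that \<open>x\<close> is not in it.\<close>
    moreover have "{p, x} \<notin> E" using twins edge_side by blast
    then have "nbrs (isolate x E) p = nbrs E p" using twins(1) by (auto simp: nbrs_isolate)
    then have "E = link_twin (x, p, a, b) (isolate x E)"
      using link_isolate[OF ab(3)] by (simp add: link_twin_def)
    ultimately show ?thesis using splits_isolate[OF twins(2)] by blast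
  next
    case irreducible
    have bridge: ?thesis if "{x, b} \<in> E" "(x, b) \<notin> conn (E - {{x, b}})" for x b
    proof -
      have "link_two (x, b, b) \<in> moves V" using edge_verts that unfolding moves_def by blast
      moreover have "E = link_two (x, b, b) (E - {{x, b}})"
        using that by (auto simp: link_two_def link_def)
      ultimately show ?thesis using splits_bridge[OF that] by blast
    qed
    \<comment> \<open>If \<open>x\<close> missed at most one neighbour of \<open>p\<close>, then,
      not being a near twin, it would have larger degree than \<open>p\<close>.\<close>
    have spread: "spread_vertex V E p"
      if max: "\<And>x w. {x, w} \<in> E \<Longrightarrow> {p, w} \<in> E \<Longrightarrow> card (nbrs E x) \<le> card (nbrs E p)" for p
    proof
      fix x w assume x: "x \<noteq> p" "{x, w} \<in> E" "{p, w} \<in> E"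
      show "2 \<le> card (nbrs E p - nbrs E x)"
      proof (rule ccontr)
        assume "\<not> 2 \<le> card (nbrs E p - nbrs E x)"
        moreover from this have "1 < card (nbrs E x - nbrs E p)" using irreducible(2)[OF x] by simp
        moreover have "card (nbrs E p - nbrs E x) = card (nbrs E p) - card (nbrs E p \<inter> nbrs E x)"
          "card (nbrs E x - nbrs E p) = card (nbrs E x) - card (nbrs E p \<inter> nbrs E x)"
          by (simp_all add: card_Diff_subset_Int Int_commute)
        ultimately show False using max[OF x(2,3)] by linarith
      qed
    qed (rule irreducible(1))
    obtain u v where "{u, v} \<in> E"
      using assms edge_card by (metis all_not_in_conv card_2_iff)
    then have uV: "u \<in> V" by (rule edge_verts)
    obtain p where "p \<in> V" and p: "\<And>x. x \<in> V \<Longrightarrow> card (nbrs E x) \<le> card (nbrs E p)"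
      using finite_maximum[OF finite_V, of "\<lambda>v. card (nbrs E v)"] uV by blast
    have "card (nbrs E p) \<noteq> 0" using p[OF uV] irreducible(1)[OF \<open>{u, v} \<in> E\<close>] by linarith
    then have "nbrs E p \<noteq> {}" by (metis card.empty)
    \<comment> \<open>Maximality among the neighbours of \<open>p\<close> is enough: by
      \<open>p_closed\<close>, every vertex sharing a neighbour with \<open>q\<close> is adjacent to
      \<open>p\<close>.\<close>
    then obtain q where pq: "{p, q} \<in> E"
        and q: "\<And>x. {p, x} \<in> E \<Longrightarrow> card (nbrs E x) \<le> card (nbrs E q)"
      using finite_maximum[OF finite_nbrs, of p "\<lambda>v. card (nbrs E v)"] by auto
    interpret P: spread_vertex V E p using p edge_verts by (intro spread) blast
    show ?thesis
    proof (cases rule: P.bridge_or_closed)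
      case closed
      note p_closed = closed
      interpret Q: spread_vertex V E q
      proof (rule spread)
        fix x w assume "{x, w} \<in> E" "{q, w} \<in> E"
        then have "{p, x} \<in> E" using p_closed[of w q x] pq by (simp add: insert_commute)
        then show "card (nbrs E x) \<le> card (nbrs E q)" by (rule q)
      qed
      show ?thesis
      proof (cases rule: Q.bridge_or_closed)
        case closed
        note q_closed = closed
        let ?E = "isolate p E"
        have "nbrs E p = insert q (\<Union>t\<in>nbrs ?E q. nbrs ?E t)"
        proof (intro equalityI subsetI)
          fix w assume "w \<in> nbrs E p"
          then have pw: "{p, w} \<in> E" "{w, p} \<in> E" by (simp_all add: insert_commute)
          \<comment> \<open>A neighbour of \<open>w\<close> other than \<open>p\<close> survives the
            isolation of \<open>p\<close> and connects \<open>w\<close> to \<open>q\<close>.\<close>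
          have "2 \<le> card (nbrs E w - {p})"
            using irreducible(1)[OF pw(2)] pw by (simp add: card_Diff_singleton)
          then obtain t where "t \<in> nbrs E w - {p}" by (rule two_le_cardE)
          then have t: "{w, t} \<in> E" "t \<noteq> p" by auto
          then have "{q, t} \<in> E" using q_closed[of w p t] pq pw by (simp add: insert_commute)
          moreover have "q \<noteq> p" "w \<noteq> p" using pq pw edge_side by blast+
          ultimately have "{q, t} \<in> ?E" "{t, w} \<in> ?E"
            using t by (simp_all add: nbrs_isolate insert_commute)
          then show "w \<in> insert q (\<Union>t\<in>nbrs ?E q. nbrs ?E t)" by auto
        next
          fix w assume w: "w \<in> insert q (\<Union>t\<in>nbrs ?E q. nbrs ?E t)"
          show "w \<in> nbrs E p"
          proof (cases "w = q")
            case False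
            then obtain t where "{q, t} \<in> E" "{t, w} \<in> E" using w by (auto simp: nbrs_isolate)
            then show ?thesis using p_closed[of t q w] pq by (simp add: insert_commute)
          qed (use pq in simp)
        qed
        then have "E = link_dominating (p, q) ?E"
          by (simp only: link_dominating_def case_prod_conv link_isolate)
        moreover have "link_dominating (p, q) \<in> moves V"
          using edge_verts[OF pq] unfolding moves_def by blast
        ultimately show ?thesis using splits_isolate[OF pq] by blast
      qed (rule bridge)
    qed (rule bridge)
  qed
qed

end

section \<open>Counting\<close>

fun generated :: "('a \<Rightarrow> 'a) set \<Rightarrow> 'a \<Rightarrow> nat \<Rightarrow> 'a set" where
  "generated M a 0 = {a}"
| "generated M a (Suc k) = (\<Union>m\<in>M. m ` generated M a k)"

lemma finite_generated: "finite M \<Longrightarrow> finite (generated M a k)"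
  by (induction k) auto

lemma card_generated: "finite M \<Longrightarrow> card (generated M a k) \<le> card M ^ k"
proof (induction k)
  case (Suc k)
  have "card (generated M a (Suc k)) \<le> (\<Sum>m\<in>M. card (m ` generated M a k))"
    using Suc.prems by (simp add: card_UN_le)
  also have "\<dots> \<le> (\<Sum>m\<in>M. card M ^ k)"
    using Suc finite_generated[OF Suc.prems]
    by (intro sum_mono) (meson card_image_le le_trans)
  finally show ?case by simp
qed simp

lemma start_in_generated: "id \<in> M \<Longrightarrow> a \<in> generated M a k"
  by (induction k) (auto intro!: bexI[of _ id])

text \<open>Each deletion step lowers the rank, so at most \<open>k\<close> moves rebuild the graph
  from the edgeless one. For \<open>k = 0\<close> no deletion is possible.\<close>

lemma class_subset_generated:
  assumes "(V, E) \<in> X_free_chordal_bipartite" "rank V E \<le> k"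
  shows "E \<in> generated (moves V) {} k"
  using assms
proof (induction k arbitrary: E)
  case (0 E)
  then interpret X_free_chordal_bipartite_graph V E by unfold_locales
  have "E = {}"
  proof (rule ccontr)
    assume "E \<noteq> {}"
    then obtain E' m where "splits E E'" using exists_move by blast
    then show False using splits_rank[of E E' V] finite_V edge_subset edge_card 0 by simp
  qed
  then show ?case by simp
next
  case (Suc k E)
  then interpret X_free_chordal_bipartite_graph V E by unfold_locales
  show ?case
  proof (cases "E = {}")
    case True
    have "id \<in> moves V" by (simp add: moves_def)
    from start_in_generated[OF this, of "{}" "Suc k"] show ?thesis using True by simp
  next
    case False
    then obtain E' m where m: "splits E E'" "m \<in> moves V" "E = m E'" using exists_move by blast
    have "rank V E' < rank V E"
      using splits_rank[OF m(1)] finite_V edge_subset edge_card by simp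
    then have "E' \<in> generated (moves V) {} k"
      using Suc.IH splits_X_free_chordal_bipartite[OF m(1)] Suc.prems by simp
    then show ?thesis using m by auto
  qed
qed

text \<open>The rank is at most \<open>n\<close>, so \<open>n\<close> moves suffice, each chosen
  among at most \<open>4 * n ^ 4\<close>.\<close>

lemma labelled_count_le:
  assumes "1 \<le> n" shows "labelled_count X_free_chordal_bipartite n \<le> (4 * n ^ 4) ^ n"
proof -
  let ?V = "{1..n}" and ?G = "generated (moves {1..n}) {} n"
  have "{G \<in> X_free_chordal_bipartite. verts G = ?V} \<subseteq> Pair ?V ` ?G"
  proof
    fix G assume "G \<in> {G \<in> X_free_chordal_bipartite. verts G = ?V}"
    then obtain E where G: "G = (?V, E)" "(?V, E) \<in> X_free_chordal_bipartite" by (cases G) auto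
    have "rank ?V E \<le> card ?V"
      unfolding rank_def by (rule card_mono) auto
    then have "E \<in> ?G" using class_subset_generated[OF G(2), of n] by simp
    then show "G \<in> Pair ?V ` ?G" using G(1) by blast
  qed
  then have "labelled_count X_free_chordal_bipartite n \<le> card (Pair ?V ` ?G)"
    unfolding labelled_count_def
    by (intro card_mono finite_imageI finite_generated finite_moves) auto
  also have "\<dots> \<le> card ?G"
    by (intro card_image_le finite_generated finite_moves) auto
  also have "\<dots> \<le> card (moves ?V) ^ n" by (intro card_generated finite_moves) auto
  also have "\<dots> \<le> (4 * n ^ 4) ^ n"
    using card_moves[of ?V] assms by (intro power_mono) auto
  finally show ?thesis .
qed

section \<open>Lower bound by star forests\<close>

lemma free_of_no_path:
  assumes path: "{a, b} \<in> edges H" "{b, c} \<in> edges H" "{c, d} \<in> edges H" "a \<noteq> c" "b \<noteq> d"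
      "a \<in> verts H" "b \<in> verts H" "c \<in> verts H" "d \<in> verts H"
    and leaf: "\<And>u v w x. {u, v} \<in> edges G \<Longrightarrow> {v, w} \<in> edges G \<Longrightarrow> {w, x} \<in> edges G \<Longrightarrow> u = w \<or> v = x"
  shows "free_of H G"
  unfolding free_of_def
proof clarify
  fix W assume "isomorphic (induced G W) H"
  then have "isomorphic H (induced G W)" by (rule isomorphic_sym)
  then obtain f where "bij_betw f (verts H) W"
    and e: "\<And>u v. u \<in> verts H \<Longrightarrow> v \<in> verts H \<Longrightarrow>
        {u, v} \<in> edges H \<longleftrightarrow> {f u, f v} \<in> edges (induced G W)"
    unfolding isomorphic_def by auto
  then have inj: "inj_on f (verts H)" by (auto simp: bij_betw_def)
  have "{f a, f b} \<in> edges G" "{f b, f c} \<in> edges G" "{f c, f d} \<in> edges G"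
    using path(1-3,6-9) e[of a b] e[of b c] e[of c d] by (simp_all add: induced_def)
  \<comment> \<open>An injective image of the walk \<open>a b c d\<close> would violate
    \<open>leaf\<close>.\<close>
  then have "f a = f c \<or> f b = f d" by (rule leaf)
  then show False using path(4-9) inj by (simp add: inj_on_eq_iff)
qed

text \<open>\<open>h\<close> assigns centres to the leaves \<open>1, ..., m\<close>; the centres
  will be taken from \<open>{m + 1..2 * m}\<close>.\<close>

definition star_forest :: "nat \<Rightarrow> (nat \<Rightarrow> nat) \<Rightarrow> nat set set" where
  "star_forest m h = (\<lambda>i. {i, h i}) ` {1..m}"

lemma star_forest_edge:
  "{u, v} \<in> star_forest m h \<longleftrightarrow> u \<in> {1..m} \<and> v = h u \<or> v \<in> {1..m} \<and> u = h v"
  unfolding star_forest_def image_iff doubleton_eq_iff by blast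

lemma star_forest_in_class:
  assumes h: "h \<in> {1..m} \<rightarrow> {m + 1..2 * m}" and "2 * m \<le> n"
  shows "({1..n}, star_forest m h) \<in> X_free_chordal_bipartite"
proof -
  let ?G = "({1..n}, star_forest m h)"
  have h': "m < h i" "h i \<le> 2 * m" if "1 \<le> i" "i \<le> m" for i using h that by (auto simp: Pi_def)
  have leaf: "u = w \<or> v = x"
    if "{u, v} \<in> edges ?G" "{v, w} \<in> edges ?G" "{w, x} \<in> edges ?G" for u v w x
  proof -
    \<comment> \<open>Leaves are never centres, so walks alternate between the two. One of the two
      inner vertices of the walk is a leaf, and its neighbours on the walk coincide.\<close>
    have nm: "\<not> (i \<in> {1..m} \<and> h j = i)" if "j \<in> {1..m}" for i j using h'[of j] that by auto
    have "u \<in> {1..m} \<and> v = h u \<or> v \<in> {1..m} \<and> u = h v"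
      "v \<in> {1..m} \<and> w = h v \<or> w \<in> {1..m} \<and> v = h w"
      "w \<in> {1..m} \<and> x = h w \<or> x \<in> {1..m} \<and> w = h x"
      using that by (simp_all add: star_forest_edge)
    then show ?thesis using nm by metis
  qed
  have "e \<subseteq> {1..n} \<and> card e = 2" if e: "e \<in> star_forest m h" for e
  proof -
    obtain i where "1 \<le> i" "i \<le> m" "e = {i, h i}" using e by (auto simp: star_forest_def)
    then show ?thesis using h'[of i] \<open>2 * m \<le> n\<close> by simp
  qed
  then have "simple_graph ?G" by (simp add: simple_graph_def)
  moreover have "bipartite ?G"
    unfolding bipartite_def
  proof (intro exI conjI ballI)
    show "{1..m} \<union> {m + 1..n} = verts ?G" "{1..m} \<inter> {m + 1..n} = {}" using \<open>2 * m \<le> n\<close> by auto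
    fix e assume "e \<in> edges ?G"
    then obtain i where "i \<in> {1..m}" "e = {i, h i}" by (auto simp: star_forest_def)
    moreover from this have "h i \<in> {m + 1..n}" using h'[of i] \<open>2 * m \<le> n\<close> by simp
    ultimately show "\<exists>a\<in>{1..m}. \<exists>b\<in>{m + 1..n}. e = {a, b}" by blast
  qed
  moreover have "free_of (cycle_graph k) ?G" if "6 \<le> k" for k
  proof (rule free_of_no_path[where a = 0 and b = 1 and c = 2 and d = 3])
    have "{i, Suc i} \<in> edges (cycle_graph k)" if "Suc i < k" for i
      using that by (auto simp: cycle_graph_def intro!: exI[of _ i])
    from this[of 0] this[of 1] this[of 2] \<open>6 \<le> k\<close>
    show "{0, 1} \<in> edges (cycle_graph k)" "{1, 2} \<in> edges (cycle_graph k)" "{2, 3} \<in> edges (cycle_graph k)"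
      by (simp_all add: numeral_eq_Suc)
    show "0 \<in> verts (cycle_graph k)" "1 \<in> verts (cycle_graph k)" "2 \<in> verts (cycle_graph k)"
      "3 \<in> verts (cycle_graph k)" using \<open>6 \<le> k\<close> by (simp_all add: cycle_graph_def)
  qed (simp_all, use leaf in simp)
  moreover have "free_of X_graph ?G"
  proof (rule free_of_no_path[where a = 1 and b = 2 and c = 3 and d = 4])
    show "{1, 2} \<in> edges X_graph" "{2, 3} \<in> edges X_graph" "{3, 4} \<in> edges X_graph"
      by (simp_all add: X_graph_def)
  qed (simp_all add: X_graph_def, use leaf in simp)
  ultimately show ?thesis by (simp add: X_free_chordal_bipartite_def chordal_bipartite_def)
qed

text \<open>The only neighbour of a leaf \<open>i\<close> is \<open>h i\<close>, so the forest
  determines \<open>h\<close>, and there are \<open>m ^ m\<close> choices for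
  \<open>m = n div 2\<close>. For odd \<open>n\<close> the last vertex is isolated.\<close>

lemma labelled_count_ge:
  assumes "1 \<le> n"
  shows "(n div 2) ^ (n div 2) \<le> labelled_count X_free_chordal_bipartite n"
proof -
  let ?m = "n div 2" and ?C = "{G \<in> X_free_chordal_bipartite. verts G = {1..n}}"
  let ?H = "{1..?m} \<rightarrow>\<^sub>E {?m + 1..2 * ?m}"
  have H: "h \<in> {1..?m} \<rightarrow> {?m + 1..2 * ?m}" if "h \<in> ?H" for h using that by (simp add: PiE_def)
  have "inj_on (\<lambda>h. ({1..n}, star_forest ?m h)) ?H"
  proof (rule inj_onI)
    fix h h' assume hh: "h \<in> ?H" "h' \<in> ?H" "({1..n}, star_forest ?m h) = ({1..n}, star_forest ?m h')"
    show "h = h'"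
    proof (rule PiE_ext[OF hh(1,2)])
      fix i assume i: "i \<in> {1..?m}"
      then have "{i, h i} \<in> star_forest ?m h" by (auto simp: star_forest_def)
      then have "{i, h i} \<in> star_forest ?m h'" using hh(3) by simp
      then have "h i = h' i \<or> h i \<in> {1..?m}"
        using star_forest_edge[of i "h i" ?m h'] by blast
      moreover have "h i \<in> {?m + 1..2 * ?m}" using H[OF hh(1)] i by blast
      ultimately show "h i = h' i" by auto
    qed
  qed
  moreover have "(\<lambda>h. ({1..n}, star_forest ?m h)) ` ?H \<subseteq> ?C"
    using star_forest_in_class[OF H, of _ n] by auto
  moreover have "?C \<subseteq> {{1..n}} \<times> Pow (Pow {1..n})"
    unfolding X_free_chordal_bipartite_def simple_graph_def by fastforce
  then have "finite ?C" by (rule finite_subset) simp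
  ultimately have "card ?H \<le> card ?C" by (rule card_inj_on_le)
  moreover have "card ?H = ?m ^ ?m" by (simp add: card_PiE)
  ultimately show ?thesis by (simp add: labelled_count_def)
qed

text \<open>Needed for taking logarithms; the case \<open>n = 1\<close> rests on
  \<open>0 ^ 0 = 1\<close>.\<close>

lemma labelled_count_pos:
  assumes "1 \<le> n" shows "0 < labelled_count X_free_chordal_bipartite n"
proof -
  have "0 < (n div 2) ^ (n div 2)" by (cases "n div 2") simp_all
  then show ?thesis using labelled_count_ge[OF assms] by linarith
qed

section \<open>Asymptotics of the logarithm of the count\<close>

lemma log_labelled_count_bigo:
  "(\<lambda>n. log 2 (labelled_count X_free_chordal_bipartite n)) \<in> O(\<lambda>n. real n * log 2 (real n))"
proof (rule bigoI[where c = 6], rule eventually_sequentiallyI[of 2])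
  fix n :: nat assume n: "2 \<le> n"
  let ?c = "labelled_count X_free_chordal_bipartite n"
  have c: "1 \<le> ?c" using labelled_count_pos[of n] n by simp
  have "log 2 2 \<le> log 2 n" using n by (subst log_le_cancel_iff) auto
  then have "1 \<le> log 2 n" by simp
  have "real ?c \<le> real ((4 * n ^ 4) ^ n)" using labelled_count_le[of n] n by (simp only: of_nat_le_iff)
  then have "log 2 ?c \<le> log 2 (real ((4 * n ^ 4) ^ n))" using c n by (subst log_le_cancel_iff) auto
  also have "\<dots> = n * (log 2 (2 ^ 2) + 4 * log 2 n)"
    using n by (simp add: log_nat_power log_mult distrib_left)
  also have "log 2 (2 ^ 2) = (2 :: real)" by (subst log_nat_power) auto
  \<comment> \<open>The constant 6 arises here: the summand 2 from the factor \<open>4\<close> is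
    absorbed into \<open>2 * log 2 n\<close>.\<close>
  also have "n * (2 + 4 * log 2 n) \<le> n * (6 * log 2 n)"
    using \<open>1 \<le> log 2 n\<close> by (intro mult_left_mono) auto
  finally have "log 2 ?c \<le> 6 * (n * log 2 n)" by simp
  moreover have "0 \<le> log 2 ?c" using c by simp
  ultimately show "norm (log 2 ?c) \<le> 6 * norm (n * log 2 n)" using \<open>1 \<le> log 2 n\<close> by simp
qed

lemma log_labelled_count_bigomega:
  "(\<lambda>n. log 2 (labelled_count X_free_chordal_bipartite n)) \<in> \<Omega>(\<lambda>n. real n * log 2 (real n))"
proof (rule landau_omega.bigI[where c = "1 / 8"], simp, rule eventually_sequentiallyI[of 16])
  fix n :: nat assume n: "16 \<le> n"
  let ?c = "labelled_count X_free_chordal_bipartite n" and ?m = "n div 2"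
  \<comment> \<open>These bounds give \<open>n \<le> ?m ^ 2\<close>, so \<open>log 2 ?m\<close> is
    at least half of \<open>log 2 n\<close>. Together with \<open>?m \<ge> n / 4\<close> this yields
    the constant \<open>1 / 8\<close>.\<close>
  have m: "n \<le> 4 * ?m" "4 \<le> ?m" using n by linarith+
  then have "n \<le> ?m ^ 2" unfolding power2_eq_square by (meson le_trans mult_le_mono1)
  then have "log 2 (real n) \<le> log 2 (real (?m ^ 2))"
    using n m by (subst log_le_cancel_iff) (auto simp only: of_nat_le_iff of_nat_0_less_iff)
  then have "log 2 n \<le> 2 * log 2 ?m" using m by (simp add: log_nat_power)
  moreover have "0 \<le> log 2 n" using n by simp
  ultimately have "(real n / 4) * (log 2 n / 2) \<le> ?m * log 2 ?m"
    using m by (intro mult_mono) auto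
  also have "\<dots> = log 2 (real (?m ^ ?m))" using m by (simp add: log_nat_power)
  also have "\<dots> \<le> log 2 ?c"
    using labelled_count_ge[of n] labelled_count_pos[of n] n m
    by (subst log_le_cancel_iff) (simp_all only: of_nat_le_iff of_nat_0_less_iff, simp_all)
  finally show "1 / 8 * norm (n * log 2 n) \<le> norm (log 2 ?c)" using \<open>0 \<le> log 2 n\<close> by simp
qed

theorem theorem19: "factorial_class X_free_chordal_bipartite"
proof -
  let ?f = "\<lambda>n. log 2 (labelled_count X_free_chordal_bipartite n)"
  have "?f \<in> \<Theta>(\<lambda>n. real n * log 2 (real n))"
    using log_labelled_count_bigo log_labelled_count_bigomega by (rule bigthetaI)
  moreover have "real (labelled_count X_free_chordal_bipartite n) = 2 powr ?f n" if "1 \<le> n" for n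
    using labelled_count_pos[OF that] by simp
  ultimately show ?thesis
    unfolding factorial_class_def using hereditary_X_free_chordal_bipartite by blast
qed

end
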